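(* Let $A=\mathbb K[x]$ and $B=\mathbb K[y]$. Let $S_n(t)\in\mathbb K[t]$ be defined by $S_1(t)=1$, $S_2(t)=1$, and $S_n(t)=S_{n-1}(t)-tS_{n-2}(t)$ for $n\ge 3$. Suppose that $c\in\mathbb K$ is not a root of $S_n(t)$ for any $n\ge 1$, and write $S_n=S_n(c)$. Then the linear map $\tau:B\otimes A\to A\otimes B$ defined by insisting that $\tau$ satisfy the unital twisting conditions and $$\tau(y^i\otimes x^j)=S_{i+j}^{-1}\left(S_j\,x^{i+j}\otimes 1_B+c^jS_i\,1_A\otimes y^{i+j}\right)\quad\text{for all } i,j\ge 1$$ is a graded twisting map. Moreover, $\tau$ has the unique extension property.
   Context: $\mathbb K$ is a field, $\otimes=\otimes_{\mathbb K}$; $x,y$ have degree $1$. $\mu_A$ is the multiplication of $A$; $1_A$ also denotes the identity map of $A$. Tensor products of graded spaces are graded by $(V\otimes W)_m=\bigoplus_{k+l=m}V_k\otimes W_l$. A linear map is graded if it preserves degree; $f_n$ is its degree $n$ component, $f_{\le n}=\bigoplus_{i\le n}f_i$. The unital twisting conditions are $\tau(1_B\otimes a)=a\otimes 1_B$ and $\tau(b\otimes 1_A)=1_A\otimes b$ for all $a\in A,b\in B$. A graded twisting map is a graded linear map $\tau:B\otimes A\to A\otimes B$ satisfying these and $\tau(\mu_B\otimes\mu_A)=(\mu_A\otimes\mu_B)(1_A\otimes\tau\otimes 1_B)(\tau\otimes\tau)(1_B\otimes\tau\otimes 1_A)$ on $B\otimes B\otimes A\otimes A$. A graded linear map $t:(B\otimes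 A)_{\le n}\to(A\otimes B)_{\le n}$ is graded twisting to degree $n$ if for each $i\le n$: $t(1_B\otimes a)=a\otimes 1_B$, $t(b\otimes 1_A)=1_A\otimes b$ for $a\in A_i$, $b\in B_i$, and $t_i(\mu_B\otimes\mu_A)=(\mu_A\otimes\mu_B)(1_A\otimes t_{\le i}\otimes 1_B)(t_{\le i}\otimes t_{\le i})(1_B\otimes t_{\le i}\otimes 1_A)$ on $(B\otimes B\otimes A\otimes A)_i$. A graded linear map $B\otimes A\to A\otimes B$ is graded twisting to degree $n$ if its restriction to $(B\otimes A)_{\le n}$ is. A graded twisting map $\tau$ has the unique extension property if for every $n\ge 3$ and every graded linear map $\tau':B\otimes A\to A\otimes B$ that is graded twisting to degree $n$ and satisfies $\tau'_i=\tau_i$ for all $i<n$, one has $\tau'_n=\tau_n$. *)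

theory Defs
  imports "HOL-Library.Poly_Mapping" "HOL-Computational_Algebra.Polynomial"
begin

section \<open>Vector spaces with a basis and their tensor products\<close>

text \<open>
  A \<open>'k\<close>-vector space with basis \<open>'i\<close> is the type \<open>'i \<Rightarrow>\<^sub>0 'k\<close>. The tensor product of the
  spaces with bases \<open>'i\<close> and \<open>'j\<close> is the space with basis \<open>'i \<times> 'j\<close>; its universal property
  is proved below. Since \<open>'i\<close> and \<open>'j\<close> are types, the two orders \<open>A \<otimes> B\<close> and
  \<open>B \<otimes> A\<close> are kept apart by typing in all general definitions.
\<close>

definition scale :: "'k::field \<Rightarrow> ('i \<Rightarrow>\<^sub>0 'k) \<Rightarrow> ('i \<Rightarrow>\<^sub>0 'k)"  (infixr \<open>*\<^sub>s\<close> 75)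
  where "c *\<^sub>s v = Poly_Mapping.map ((*) c) v"

abbreviation basis :: "'i \<Rightarrow> ('i \<Rightarrow>\<^sub>0 'k::field)"
  where "basis i \<equiv> Poly_Mapping.single i 1"

abbreviation klinear :: "(('i \<Rightarrow>\<^sub>0 'k::field) \<Rightarrow> ('j \<Rightarrow>\<^sub>0 'k)) \<Rightarrow> bool"
  where "klinear f \<equiv> Vector_Spaces.linear scale scale f"

text \<open>The linear map with prescribed values on the basis.\<close>

definition lin_ext :: "('i \<Rightarrow> ('j \<Rightarrow>\<^sub>0 'k)) \<Rightarrow> ('i \<Rightarrow>\<^sub>0 'k::field) \<Rightarrow> ('j \<Rightarrow>\<^sub>0 'k)"
  where "lin_ext b v = (\<Sum>i\<in>Poly_Mapping.keys v. Poly_Mapping.lookup v i *\<^sub>s b i)"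

definition tensor :: "('i \<Rightarrow>\<^sub>0 'k::field) \<Rightarrow> ('j \<Rightarrow>\<^sub>0 'k) \<Rightarrow> ('i \<times> 'j \<Rightarrow>\<^sub>0 'k)"
    (infixr \<open>\<otimes>\<close> 70)
  where "v \<otimes> w = (\<Sum>i\<in>Poly_Mapping.keys v. \<Sum>j\<in>Poly_Mapping.keys w.
           Poly_Mapping.single (i, j) (Poly_Mapping.lookup v i * Poly_Mapping.lookup w j))"

definition tensor_map ::
    "(('i \<Rightarrow>\<^sub>0 'k) \<Rightarrow> ('i' \<Rightarrow>\<^sub>0 'k)) \<Rightarrow> (('j \<Rightarrow>\<^sub>0 'k) \<Rightarrow> ('j' \<Rightarrow>\<^sub>0 'k))
      \<Rightarrow> ('i \<times> 'j \<Rightarrow>\<^sub>0 'k::field) \<Rightarrow> ('i' \<times> 'j' \<Rightarrow>\<^sub>0 'k)"  (infixr \<open>\<otimes>\<^sub>m\<close> 70)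
  where "f \<otimes>\<^sub>m g = lin_ext (\<lambda>(i, j). f (basis i) \<otimes> g (basis j))"

text \<open>
  A fourfold tensor product is bracketed as \<open>(U \<otimes> V) \<otimes> (W \<otimes> X)\<close>. The next two maps are the
  canonical rebracketings, and \<open>mid f\<close> is \<open>1 \<otimes> f \<otimes> 1\<close> with these rebracketings inserted.
\<close>

definition assoc_in ::
    "(('u \<times> 'v) \<times> ('w \<times> 'x) \<Rightarrow>\<^sub>0 'k::field) \<Rightarrow> ('u \<times> (('v \<times> 'w) \<times> 'x) \<Rightarrow>\<^sub>0 'k)"
  where "assoc_in = lin_ext (\<lambda>((u, v), (w, x)). basis (u, ((v, w), x)))"

definition assoc_out ::
    "('u \<times> (('v \<times> 'w) \<times> 'x) \<Rightarrow>\<^sub>0 'k::field) \<Rightarrow> (('u \<times> 'v) \<times> ('w \<times> 'x) \<Rightarrow>\<^sub>0 'k)"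
  where "assoc_out = lin_ext (\<lambda>(u, ((v, w), x)). basis ((u, v), (w, x)))"

definition mid ::
    "(('v \<times> 'w \<Rightarrow>\<^sub>0 'k::field) \<Rightarrow> ('v' \<times> 'w' \<Rightarrow>\<^sub>0 'k))
      \<Rightarrow> (('u \<times> 'v) \<times> ('w \<times> 'x) \<Rightarrow>\<^sub>0 'k) \<Rightarrow> (('u \<times> 'v') \<times> ('w' \<times> 'x) \<Rightarrow>\<^sub>0 'k)"
  where "mid f = assoc_out \<circ> (id \<otimes>\<^sub>m (f \<otimes>\<^sub>m id)) \<circ> assoc_in"


section \<open>Gradings\<close>

class graded_index =
  fixes gdeg :: "'a \<Rightarrow> nat"

class graded_monoid = monoid_add + graded_index +
  assumes gdeg_zero: "gdeg 0 = 0"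
    and gdeg_add: "gdeg (a + b) = gdeg a + gdeg b"

instantiation nat :: graded_monoid
begin
definition gdeg_nat :: "nat \<Rightarrow> nat" where "gdeg_nat n = n"
instance by standard (simp_all add: gdeg_nat_def)
end

instantiation prod :: (graded_index, graded_index) graded_index
begin
definition gdeg_prod :: "'a \<times> 'b \<Rightarrow> nat" where "gdeg_prod p = gdeg (fst p) + gdeg (snd p)"
instance ..
end

definition homogeneous :: "nat \<Rightarrow> ('i::graded_index \<Rightarrow>\<^sub>0 'k::field) set"
  where "homogeneous n = {v. \<forall>i\<in>Poly_Mapping.keys v. gdeg i = n}"

definition hproj :: "nat \<Rightarrow> ('i::graded_index \<Rightarrow>\<^sub>0 'k::field) \<Rightarrow> ('i \<Rightarrow>\<^sub>0 'k)"
  where "hproj n v = Poly_Mapping.mapp (\<lambda>i a. if gdeg i = n then a else 0) v"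

definition graded_linear ::
    "(('i::graded_index \<Rightarrow>\<^sub>0 'k::field) \<Rightarrow> ('j::graded_index \<Rightarrow>\<^sub>0 'k)) \<Rightarrow> bool"
  where "graded_linear f \<longleftrightarrow> klinear f \<and> (\<forall>n. \<forall>v\<in>homogeneous n. f v \<in> homogeneous n)"

text \<open>
  The components \<open>f\<^sub>n\<close> and \<open>f\<^sub>\<le>\<^sub>n\<close> of a graded map, extended by zero to the whole space.
\<close>

definition component ::
    "nat \<Rightarrow> (('i::graded_index \<Rightarrow>\<^sub>0 'k::field) \<Rightarrow> ('j \<Rightarrow>\<^sub>0 'k)) \<Rightarrow> ('i \<Rightarrow>\<^sub>0 'k) \<Rightarrow> ('j \<Rightarrow>\<^sub>0 'k)"
  where "component n f v = f (hproj n v)"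

definition component_le ::
    "nat \<Rightarrow> (('i::graded_index \<Rightarrow>\<^sub>0 'k::field) \<Rightarrow> ('j \<Rightarrow>\<^sub>0 'k)) \<Rightarrow> ('i \<Rightarrow>\<^sub>0 'k) \<Rightarrow> ('j \<Rightarrow>\<^sub>0 'k)"
  where "component_le n f v = (\<Sum>i\<le>n. component i f v)"


section \<open>Twisting maps\<close>

text \<open>
  For a monoid \<open>'i\<close> the product on \<open>'i \<Rightarrow>\<^sub>0 'k\<close> is that of the monoid algebra; for
  \<open>'i = nat\<close> this is the polynomial ring in one variable (see \<open>to_poly\<close> below).
  \<open>alg_mult\<close> is the multiplication as a linear map on the tensor square.
\<close>

definition alg_mult :: "('i::monoid_add \<times> 'i \<Rightarrow>\<^sub>0 'k::field) \<Rightarrow> ('i \<Rightarrow>\<^sub>0 'k)"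
  where "alg_mult = lin_ext (\<lambda>(i, j). basis i * basis j)"

definition unital_twisting ::
    "(('j::monoid_add \<times> 'i::monoid_add \<Rightarrow>\<^sub>0 'k::field) \<Rightarrow> ('i \<times> 'j \<Rightarrow>\<^sub>0 'k)) \<Rightarrow> bool"
  where "unital_twisting t \<longleftrightarrow> (\<forall>a. t (1 \<otimes> a) = a \<otimes> 1) \<and> (\<forall>b. t (b \<otimes> 1) = 1 \<otimes> b)"

definition graded_twisting_map ::
    "(('j::graded_monoid \<times> 'i::graded_monoid \<Rightarrow>\<^sub>0 'k::field) \<Rightarrow> ('i \<times> 'j \<Rightarrow>\<^sub>0 'k)) \<Rightarrow> bool"
  where "graded_twisting_map t \<longleftrightarrow> graded_linear t \<and> unital_twisting t \<and>
    t \<circ> (alg_mult \<otimes>\<^sub>m alg_mult) = (alg_mult \<otimes>\<^sub>m alg_mult) \<circ> mid t \<circ> (t \<otimes>\<^sub>m t) \<circ> mid t"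

text \<open>
  For a graded linear map \<open>t\<close> on all of \<open>B \<otimes> A\<close>: the restriction of \<open>t\<close> to degrees at most \<open>n\<close>
  is graded twisting to degree \<open>n\<close>. Only the values of \<open>t\<close> in degrees at most \<open>n\<close> enter below,
  and for \<open>i \<le> n\<close> the restriction has the same components \<open>t\<^sub>i\<close> and \<open>t\<^sub>\<le>\<^sub>i\<close> as \<open>t\<close>.
\<close>

definition graded_twisting_to_degree ::
    "nat \<Rightarrow> (('j::graded_monoid \<times> 'i::graded_monoid \<Rightarrow>\<^sub>0 'k::field) \<Rightarrow> ('i \<times> 'j \<Rightarrow>\<^sub>0 'k)) \<Rightarrow> bool"
  where "graded_twisting_to_degree n t \<longleftrightarrow> graded_linear t \<and>
    (\<forall>i\<le>n.
      (\<forall>a\<in>homogeneous i. t (1 \<otimes> a) = a \<otimes> 1) \<and>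
      (\<forall>b\<in>homogeneous i. t (b \<otimes> 1) = 1 \<otimes> b) \<and>
      (\<forall>v\<in>homogeneous i.
        component i t ((alg_mult \<otimes>\<^sub>m alg_mult) v) =
          (alg_mult \<otimes>\<^sub>m alg_mult)
            (mid (component_le i t) ((component_le i t \<otimes>\<^sub>m component_le i t) (mid (component_le i t) v)))))"

definition unique_extension_property ::
    "(('j::graded_monoid \<times> 'i::graded_monoid \<Rightarrow>\<^sub>0 'k::field) \<Rightarrow> ('i \<times> 'j \<Rightarrow>\<^sub>0 'k)) \<Rightarrow> bool"
  where "unique_extension_property t \<longleftrightarrow>
    (\<forall>n\<ge>3. \<forall>t'. graded_linear t' \<and> graded_twisting_to_degree n t' \<and>
        (\<forall>i<n. component i t' = component i t) \<longrightarrow> component n t' = component n t)"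


section \<open>The twisting maps on polynomial rings\<close>

text \<open>
  \<open>\<bbbK>[x]\<close> and \<open>\<bbbK>[y]\<close> are both \<open>nat \<Rightarrow>\<^sub>0 'k\<close>, with the variable \<open>indet\<close> in degree \<open>1\<close>.
\<close>

definition indet :: "nat \<Rightarrow>\<^sub>0 'k::field"
  where "indet = Poly_Mapping.single 1 1"

text \<open>The value at \<open>0\<close> is a dummy.\<close>

fun S_poly :: "nat \<Rightarrow> 'k::field poly" where
  "S_poly 0 = 0"
| "S_poly (Suc 0) = 1"
| "S_poly (Suc (Suc 0)) = 1"
| "S_poly (Suc (Suc (Suc n))) = S_poly (Suc (Suc n)) - [:0, 1:] * S_poly (Suc n)"

definition defining_conditions :: "'k::field \<Rightarrow> ((nat \<times> nat \<Rightarrow>\<^sub>0 'k) \<Rightarrow> (nat \<times> nat \<Rightarrow>\<^sub>0 'k)) \<Rightarrow> bool"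
  where "defining_conditions c t \<longleftrightarrow> klinear t \<and> unital_twisting t \<and>
    (let S = (\<lambda>n. poly (S_poly n) c) in
      \<forall>i\<ge>1. \<forall>j\<ge>1. t (indet ^ i \<otimes> indet ^ j) =
        inverse (S (i + j)) *\<^sub>s
          (S j *\<^sub>s (indet ^ (i + j) \<otimes> 1) + (c ^ j * S i) *\<^sub>s (1 \<otimes> indet ^ (i + j))))"


section \<open>Adequacy of the encoding\<close>

lemma lookup_scale [simp]: "Poly_Mapping.lookup (c *\<^sub>s v) i = c * Poly_Mapping.lookup v i"
  by (simp add: scale_def Poly_Mapping.map.rep_eq when_def)

lemma vector_space_scale: "vector_space (scale :: 'k::field \<Rightarrow> ('i \<Rightarrow>\<^sub>0 'k) \<Rightarrow> _)"
  by unfold_locales (auto intro!: poly_mapping_eqI simp: lookup_add algebra_simps)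

interpretation pm: vector_space "scale :: 'k::field \<Rightarrow> ('i \<Rightarrow>\<^sub>0 'k) \<Rightarrow> _"
  by (rule vector_space_scale)

lemma lookup_tensor [simp]:
  "Poly_Mapping.lookup (v \<otimes> w) (i, j) = Poly_Mapping.lookup v i * Poly_Mapping.lookup w j"
proof -
  have "Poly_Mapping.lookup (v \<otimes> w) (i, j) =
    (\<Sum>i'\<in>Poly_Mapping.keys v. \<Sum>j'\<in>Poly_Mapping.keys w.
       if i' = i then (if j' = j then Poly_Mapping.lookup v i * Poly_Mapping.lookup w j else 0) else 0)"
    by (auto simp: tensor_def lookup_sum lookup_single when_def intro!: sum.cong)
  also have "\<dots> = (\<Sum>i'\<in>Poly_Mapping.keys v. if i' = i then
       (\<Sum>j'\<in>Poly_Mapping.keys w. if j' = j then Poly_Mapping.lookup v i * Poly_Mapping.lookup w j else 0) else 0)"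
    by (intro sum.cong) auto
  also have "\<dots> = Poly_Mapping.lookup v i * Poly_Mapping.lookup w j"
    by (auto simp: in_keys_iff)
  finally show ?thesis .
qed

lemma expand_basis: "v = (\<Sum>i\<in>Poly_Mapping.keys v. Poly_Mapping.lookup v i *\<^sub>s basis i)"
proof (rule poly_mapping_eqI)
  fix k
  have "(\<Sum>i\<in>Poly_Mapping.keys v. Poly_Mapping.lookup v i * Poly_Mapping.lookup (basis i) k)
      = (\<Sum>i\<in>Poly_Mapping.keys v. if i = k then Poly_Mapping.lookup v k else 0)"
    by (intro sum.cong) (auto simp: lookup_single)
  also have "\<dots> = Poly_Mapping.lookup v k"
    by (auto simp: in_keys_iff)
  finally show "Poly_Mapping.lookup v k =
      Poly_Mapping.lookup (\<Sum>i\<in>Poly_Mapping.keys v. Poly_Mapping.lookup v i *\<^sub>s basis i) k"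
    by (simp add: lookup_sum)
qed

lemma tensor_basis [simp]: "basis i \<otimes> basis j = basis (i, j)"
  by (simp add: tensor_def)

lemma linear_tensor_left: "klinear (\<lambda>v. v \<otimes> w)"
  by (unfold_locales) (auto intro!: poly_mapping_eqI simp: lookup_add algebra_simps)

lemma linear_tensor_right: "klinear (\<lambda>w. v \<otimes> w)"
  by (unfold_locales) (auto intro!: poly_mapping_eqI simp: lookup_add algebra_simps)

lemma linear_sum_keys:
  fixes s :: "'k::field \<Rightarrow> 'v::ab_group_add \<Rightarrow> 'v" and b :: "'i \<Rightarrow> 'v"
  assumes "vector_space s"
  shows "Vector_Spaces.linear scale s
    (\<lambda>v. \<Sum>i\<in>Poly_Mapping.keys v. s (Poly_Mapping.lookup v i) (b i))"
proof -
  interpret W: vector_space s by fact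
  have ext: "(\<Sum>i\<in>Poly_Mapping.keys v. s (Poly_Mapping.lookup v i) (b i))
      = (\<Sum>i\<in>T. s (Poly_Mapping.lookup v i) (b i))"
    if "finite T" "Poly_Mapping.keys v \<subseteq> T" for v T
    by (rule sum.mono_neutral_left) (use that in \<open>auto simp: in_keys_iff\<close>)
  show ?thesis
  proof unfold_locales
    fix v w :: "'i \<Rightarrow>\<^sub>0 'k"
    let ?T = "Poly_Mapping.keys v \<union> Poly_Mapping.keys w"
    show "(\<Sum>i\<in>Poly_Mapping.keys (v + w). s (Poly_Mapping.lookup (v + w) i) (b i)) =
      (\<Sum>i\<in>Poly_Mapping.keys v. s (Poly_Mapping.lookup v i) (b i)) +
      (\<Sum>i\<in>Poly_Mapping.keys w. s (Poly_Mapping.lookup w i) (b i))"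
      using ext[of ?T "v + w"] ext[of ?T v] ext[of ?T w] Poly_Mapping.keys_add[of v w]
      by (simp add: lookup_add W.scale_left_distrib sum.distrib)
  next
    fix c and v :: "'i \<Rightarrow>\<^sub>0 'k"
    have "Poly_Mapping.keys (c *\<^sub>s v) \<subseteq> Poly_Mapping.keys v"
      by (auto simp: in_keys_iff)
    then show "(\<Sum>i\<in>Poly_Mapping.keys (c *\<^sub>s v). s (Poly_Mapping.lookup (c *\<^sub>s v) i) (b i)) =
      s c (\<Sum>i\<in>Poly_Mapping.keys v. s (Poly_Mapping.lookup v i) (b i))"
      using ext[of "Poly_Mapping.keys v" "c *\<^sub>s v"]
      by (simp add: W.scale_sum_right)
  qed
qed

lemma linear_lin_ext: "klinear (lin_ext b)"
  unfolding lin_ext_def[abs_def] by (rule linear_sum_keys[OF vector_space_scale])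

lemma lin_ext_basis [simp]: "lin_ext b (basis i) = b i"
  by (auto simp: lin_ext_def intro!: poly_mapping_eqI)

lemma linear_expand:
  assumes "Vector_Spaces.linear scale s f"
  shows "f v = (\<Sum>i\<in>Poly_Mapping.keys v. s (Poly_Mapping.lookup v i) (f (basis i)))"
proof -
  interpret f: Vector_Spaces.linear scale s f by fact
  show ?thesis
    by (subst expand_basis[of v]) (simp only: f.sum f.scale)
qed

lemma linear_eqI:
  assumes "Vector_Spaces.linear scale s f" "Vector_Spaces.linear scale s g"
    and "\<And>i. f (basis i) = g (basis i)"
  shows "f = g"
proof
  fix v show "f v = g v"
    by (simp only: linear_expand[OF assms(1), of v] linear_expand[OF assms(2), of v] assms(3))
qed

theorem tensor_universal:
  fixes s :: "'k::field \<Rightarrow> 'v::ab_group_add \<Rightarrow> 'v"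
    and b :: "('i \<Rightarrow>\<^sub>0 'k) \<Rightarrow> ('j \<Rightarrow>\<^sub>0 'k) \<Rightarrow> 'v"
  assumes "vector_space s"
    and 1: "\<And>w. Vector_Spaces.linear scale s (\<lambda>v. b v w)"
    and 2: "\<And>v. Vector_Spaces.linear scale s (\<lambda>w. b v w)"
  shows "\<exists>!h. Vector_Spaces.linear scale s h \<and> (\<forall>v w. h (v \<otimes> w) = b v w)"
proof (rule ex1I)
  interpret W: vector_space s by fact
  define h where "h = (\<lambda>u. \<Sum>p\<in>Poly_Mapping.keys u.
      s (Poly_Mapping.lookup u p) (b (basis (fst p)) (basis (snd p))))"
  have lin: "Vector_Spaces.linear scale s h"
    unfolding h_def by (rule linear_sum_keys) fact
  have hb: "h (basis p) = b (basis (fst p)) (basis (snd p))" for p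
    by (simp add: h_def)
  have "h (v \<otimes> w) = b v w" for v w
  proof -
    have c1: "Vector_Spaces.linear scale s (\<lambda>v. h (v \<otimes> w))" for w
      using Vector_Spaces.linear_compose[OF linear_tensor_left lin] by (simp add: o_def)
    have c2: "Vector_Spaces.linear scale s (\<lambda>w. h (v \<otimes> w))" for v
      using Vector_Spaces.linear_compose[OF linear_tensor_right lin] by (simp add: o_def)
    have "(\<lambda>w. h (basis i \<otimes> w)) = (\<lambda>w. b (basis i) w)" for i
      by (rule linear_eqI[OF c2 2]) (simp add: hb)
    then have "h (basis i \<otimes> w) = b (basis i) w" for i w by (rule fun_cong)
    then have "(\<lambda>v. h (v \<otimes> w)) = (\<lambda>v. b v w)"
      by (intro linear_eqI[OF c1 1])
    then show ?thesis by (rule fun_cong)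
  qed
  with lin show "Vector_Spaces.linear scale s h \<and> (\<forall>v w. h (v \<otimes> w) = b v w)" by blast
  fix g assume g: "Vector_Spaces.linear scale s g \<and> (\<forall>v w. g (v \<otimes> w) = b v w)"
  then have "g (basis (i, j)) = h (basis (i, j))" for i j
    by (metis tensor_basis hb fst_conv snd_conv)
  then show "g = h"
    by (intro linear_eqI[OF conjunct1[OF g] lin]) auto
qed

lemma tensor_map_tensor:
  assumes "klinear f" "klinear g"
  shows "(f \<otimes>\<^sub>m g) (v \<otimes> w) = f v \<otimes> g w"
proof -
  have 1: "klinear (\<lambda>v. (f \<otimes>\<^sub>m g) (v \<otimes> w))" for w
    using Vector_Spaces.linear_compose[OF linear_tensor_left linear_lin_ext]
    by (simp add: o_def tensor_map_def)
  have 2: "klinear (\<lambda>w. (f \<otimes>\<^sub>m g) (v \<otimes> w))" for v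
    using Vector_Spaces.linear_compose[OF linear_tensor_right linear_lin_ext]
    by (simp add: o_def tensor_map_def)
  have 3: "klinear (\<lambda>v. f v \<otimes> g w)" for w
    using Vector_Spaces.linear_compose[OF assms(1) linear_tensor_left] by (simp add: o_def)
  have 4: "klinear (\<lambda>w. f v \<otimes> g w)" for v
    using Vector_Spaces.linear_compose[OF assms(2) linear_tensor_right] by (simp add: o_def)
  have "(\<lambda>w. (f \<otimes>\<^sub>m g) (basis i \<otimes> w)) = (\<lambda>w. f (basis i) \<otimes> g w)" for i
    by (rule linear_eqI[OF 2 4]) (simp add: tensor_map_def)
  then have "(f \<otimes>\<^sub>m g) (basis i \<otimes> w) = f (basis i) \<otimes> g w" for i w by (rule fun_cong)
  then have "(\<lambda>v. (f \<otimes>\<^sub>m g) (v \<otimes> w)) = (\<lambda>v. f v \<otimes> g w)"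
    by (intro linear_eqI[OF 1 3])
  then show ?thesis by (rule fun_cong)
qed

lemma homogeneous_tensor:
  "(homogeneous m :: ('i::graded_index \<times> 'j::graded_index \<Rightarrow>\<^sub>0 'k::field) set) =
     pm.span {v \<otimes> w | v w. \<exists>k l. k + l = m \<and> v \<in> homogeneous k \<and> w \<in> homogeneous l}"
    (is "_ = pm.span ?G")
proof
  show "homogeneous m \<subseteq> pm.span ?G"
  proof
    fix u :: "'i \<times> 'j \<Rightarrow>\<^sub>0 'k" assume u: "u \<in> homogeneous m"
    have "basis p \<in> ?G" if p: "p \<in> Poly_Mapping.keys u" for p
    proof -
      obtain i j where ij: "p = (i, j)" by fastforce
      have "gdeg i + gdeg j = m"
        using u p ij by (auto simp: homogeneous_def gdeg_prod_def)
      moreover have "basis i \<in> homogeneous (gdeg i)" "basis j \<in> homogeneous (gdeg j)"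
        by (auto simp: homogeneous_def)
      moreover have "basis p = basis i \<otimes> basis j" by (simp add: ij)
      ultimately show ?thesis by blast
    qed
    then show "u \<in> pm.span ?G"
      by (subst expand_basis[of u]) (intro pm.span_sum pm.span_scale pm.span_base)
  qed
  have "pm.subspace (homogeneous m :: ('i \<times> 'j \<Rightarrow>\<^sub>0 'k) set)"
    unfolding pm.subspace_def homogeneous_def
    by (auto simp: in_keys_iff lookup_add)
  moreover have "?G \<subseteq> homogeneous m"
    by (fastforce simp: homogeneous_def in_keys_iff gdeg_prod_def)
  ultimately show "pm.span ?G \<subseteq> homogeneous m"
    by (intro pm.span_minimal)
qed

lemma alg_mult_tensor: "alg_mult (v \<otimes> w) = v * w"
proof -
  have 1: "klinear (\<lambda>v. alg_mult (v \<otimes> w))" for w :: "'a \<Rightarrow>\<^sub>0 'b"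
    using Vector_Spaces.linear_compose[OF linear_tensor_left linear_lin_ext]
    by (simp add: o_def alg_mult_def)
  have 2: "klinear (\<lambda>w. alg_mult (v \<otimes> w))" for v :: "'a \<Rightarrow>\<^sub>0 'b"
    using Vector_Spaces.linear_compose[OF linear_tensor_right linear_lin_ext]
    by (simp add: o_def alg_mult_def)
  have sc: "c *\<^sub>s v = Poly_Mapping.single 0 c * v" for c and v :: "'a \<Rightarrow>\<^sub>0 'b"
    by (simp add: scale_def mult_map_scale_conv_mult)
  have sc': "basis i * (c *\<^sub>s w) = c *\<^sub>s (basis i * w)" for i c and w :: "'a \<Rightarrow>\<^sub>0 'b"
    by (simp add: sc mult.assoc[symmetric] mult_single)
  have 3: "klinear (\<lambda>v. v * w)" for w :: "'a \<Rightarrow>\<^sub>0 'b"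
    by unfold_locales (auto simp: sc algebra_simps)
  have 4: "klinear (\<lambda>w :: 'a \<Rightarrow>\<^sub>0 'b. basis i * w)" for i
    by unfold_locales (auto simp: sc' distrib_left)
  have "(\<lambda>w :: 'a \<Rightarrow>\<^sub>0 'b. alg_mult (basis i \<otimes> w)) = (\<lambda>w. basis i * w)" for i :: 'a
    by (rule linear_eqI[OF 2 4]) (simp add: alg_mult_def)
  then have "alg_mult (basis i \<otimes> w) = basis i * w" for i :: 'a and w :: "'a \<Rightarrow>\<^sub>0 'b" by (rule fun_cong)
  then have "(\<lambda>v. alg_mult (v \<otimes> w)) = (\<lambda>v. v * w)"
    by (intro linear_eqI[OF 1 3])
  then show ?thesis by (rule fun_cong)
qed

text \<open>The identification of \<open>nat \<Rightarrow>\<^sub>0 'k\<close> with the polynomial ring.\<close>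

definition to_poly :: "(nat \<Rightarrow>\<^sub>0 'k::field) \<Rightarrow> 'k poly"
  where "to_poly v = Abs_poly (Poly_Mapping.lookup v)"

lemma coeff_to_poly [simp]: "coeff (to_poly v) = Poly_Mapping.lookup v"
  unfolding to_poly_def
  by (rule Abs_poly_inverse) (simp add: MOST_iff_cofinite)

lemma bij_to_poly: "bij (to_poly :: (nat \<Rightarrow>\<^sub>0 'k::field) \<Rightarrow> 'k poly)"
proof (rule bijI)
  show "inj (to_poly :: (nat \<Rightarrow>\<^sub>0 'k) \<Rightarrow> 'k poly)"
    by (metis injI coeff_to_poly poly_mapping_eq_iff)
  show "surj (to_poly :: (nat \<Rightarrow>\<^sub>0 'k) \<Rightarrow> 'k poly)"
  proof (rule surjI)
    fix p :: "'k poly"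
    have "finite {n. coeff p n \<noteq> 0}"
      by (rule finite_subset[of _ "{..degree p}"]) (auto intro: le_degree)
    then show "to_poly (Abs_poly_mapping (coeff p)) = p"
      by (intro poly_eqI) simp
  qed
qed

lemma to_poly_add: "to_poly (v + w) = to_poly v + to_poly w"
  by (simp add: poly_eq_iff lookup_add)

lemma to_poly_scale: "to_poly (c *\<^sub>s v) = smult c (to_poly v)"
  by (simp add: poly_eq_iff)

lemma to_poly_basis: "to_poly (basis n) = monom 1 n"
  by (simp add: poly_eq_iff lookup_single when_def)

lemma to_poly_one: "to_poly 1 = 1"
  by (simp add: poly_eq_iff lookup_one when_def)

lemma to_poly_indet: "to_poly indet = [:0, 1:]"
  by (simp add: indet_def to_poly_basis monom_altdef)

lemma to_poly_zero: "to_poly 0 = 0"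
  by (simp add: poly_eq_iff)

lemma to_poly_sum: "to_poly (sum f I) = (\<Sum>i\<in>I. to_poly (f i))"
  by (induction I rule: infinite_finite_induct) (auto simp: to_poly_add to_poly_zero)

lemma to_poly_mult: "to_poly (v * w) = to_poly v * to_poly w"
proof -
  have single: "Poly_Mapping.single i c = c *\<^sub>s basis i" for i :: nat and c :: 'a
    by (auto intro!: poly_mapping_eqI simp: lookup_single when_def)
  have sc: "(a *\<^sub>s basis i) * (b *\<^sub>s basis j) = (a * b) *\<^sub>s basis (i + j)"
    for i j :: nat and a b :: 'a
    unfolding single[symmetric] by (simp add: mult_single)
  show ?thesis
    by (subst (1 2) expand_basis[of v], subst (1 2) expand_basis[of w])
      (simp add: sum_product sc to_poly_sum to_poly_scale to_poly_basis mult_monom smult_monom)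
qed

end

theory Submission
  imports Defs
begin

text \<open>
  With \<open>S\<^sub>0 = 0\<close> the displayed formula for \<open>\<tau>\<close> also covers the unital conditions in positive
  degree, and both hexagon identities for \<open>\<tau>\<close> reduce to
  \<open>S\<^sub>a\<^sub>+\<^sub>b S\<^sub>b\<^sub>+\<^sub>d = S\<^sub>b S\<^sub>a\<^sub>+\<^sub>b\<^sub>+\<^sub>d + c\<^sup>b S\<^sub>a S\<^sub>d\<close>; they imply the twisting equation.

  For unique extension, let \<open>D\<close> be the difference of \<open>\<tau>'\<close> and \<open>\<tau>\<close> in degree \<open>n\<close>. The hexagons
  make it satisfy \<open>D(y\<^sup>n\<^sup>-\<^sup>d \<otimes> x\<^sup>d) = (S\<^sub>d / S\<^sub>n\<^sub>-\<^sub>1) D(y \<otimes> x\<^sup>n\<^sup>-\<^sup>1)\<close> and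
  \<open>D(y \<otimes> x\<^sup>n\<^sup>-\<^sup>1) = (c\<^sup>n\<^sup>-\<^sup>2 / S\<^sub>n\<^sub>-\<^sub>1) D(y\<^sup>n\<^sup>-\<^sup>1 \<otimes> x)\<close>. Hence \<open>S\<^sub>n\<^sub>-\<^sub>1\<^sup>2 - c\<^sup>n\<^sup>-\<^sup>2 = S\<^sub>n\<^sub>-\<^sub>2 S\<^sub>n \<noteq> 0\<close>
  annihilates \<open>D(y \<otimes> x\<^sup>n\<^sup>-\<^sup>1)\<close>, and \<open>D = 0\<close>.
\<close>

section \<open>Linear maps and tensor products on basis vectors\<close>

lemma klinear_add:
  assumes "klinear f"
  shows "f (u + v) = f u + f v"
proof -
  interpret f: Vector_Spaces.linear scale scale f by fact
  show ?thesis by (rule f.add)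
qed

lemma klinear_scale:
  assumes "klinear f"
  shows "f (a *\<^sub>s u) = a *\<^sub>s f u"
proof -
  interpret f: Vector_Spaces.linear scale scale f by fact
  show ?thesis by (rule f.scale)
qed

lemmas klinear_simps = klinear_add klinear_scale

lemma klinear_compose: "klinear f \<Longrightarrow> klinear g \<Longrightarrow> klinear (\<lambda>v. g (f v))"
  using Vector_Spaces.linear_compose[of scale scale f scale g] by (simp add: o_def)

lemma klinear_tensor_map: "klinear (f \<otimes>\<^sub>m g)"
  unfolding tensor_map_def by (rule linear_lin_ext)

lemma klinear_mid: "klinear (mid f)"
  unfolding mid_def o_def assoc_out_def assoc_in_def
  by (intro klinear_compose[OF _ linear_lin_ext] klinear_compose[OF _ klinear_tensor_map]
      linear_lin_ext)

lemma tensor_map_basis: "(f \<otimes>\<^sub>m g) (basis (i, j)) = f (basis i) \<otimes> g (basis j)"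
  by (simp add: tensor_map_def)

lemma alg_mult_basis: "alg_mult (basis (i, j)) = basis (i + j)"
  by (simp add: alg_mult_def mult_single)

text \<open>The outer factors u and x are only labels: both sides are linear in the middle tensor
  and agree on basis vectors. This reduces calculations with \<open>mid f\<close> to the values of
  f.\<close>

lemma mid_basis:
  "mid f (basis ((u, v), (w, x))) =
     lin_ext (\<lambda>(v', w'). basis ((u, v'), (w', x))) (f (basis (v, w)))"
proof -
  have lin: "klinear (\<lambda>z. assoc_out (basis u \<otimes> (z \<otimes> basis x)))"
    unfolding assoc_out_def
    by (intro klinear_compose[OF _ linear_lin_ext] klinear_compose[OF _ linear_tensor_right]
        linear_tensor_left)
  have "(\<lambda>z. assoc_out (basis u \<otimes> (z \<otimes> basis x)))
      = lin_ext (\<lambda>(v', w'). basis ((u, v'), (w', x)))"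
    by (rule linear_eqI[OF lin linear_lin_ext]) (auto simp: assoc_out_def)
  then have "assoc_out (basis u \<otimes> (z \<otimes> basis x))
      = lin_ext (\<lambda>(v', w'). basis ((u, v'), (w', x))) z" for z
    by (rule fun_cong)
  then show ?thesis
    by (simp add: mid_def assoc_in_def tensor_map_basis)
qed

lemma tensor_add_left: "(u + v) \<otimes> w = u \<otimes> w + v \<otimes> w"
  by (rule klinear_add[OF linear_tensor_left])

lemma tensor_add_right: "w \<otimes> (u + v) = w \<otimes> u + w \<otimes> v"
  by (rule klinear_add[OF linear_tensor_right])

lemma tensor_scale_left: "(a *\<^sub>s v) \<otimes> w = a *\<^sub>s (v \<otimes> w)"
  by (rule klinear_scale[OF linear_tensor_left])

lemma tensor_scale_right: "w \<otimes> (a *\<^sub>s v) = a *\<^sub>s (w \<otimes> v)"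
  by (rule klinear_scale[OF linear_tensor_right])

lemmas tensor_simps = tensor_add_left tensor_add_right tensor_scale_left tensor_scale_right

section \<open>Homogeneous vectors and graded components\<close>

lemma homogeneous_add: "u \<in> homogeneous n \<Longrightarrow> v \<in> homogeneous n \<Longrightarrow> u + v \<in> homogeneous n"
  using Poly_Mapping.keys_add[of u v] by (auto simp: homogeneous_def)

lemma homogeneous_scale: "u \<in> homogeneous n \<Longrightarrow> a *\<^sub>s u \<in> homogeneous n"
  by (auto simp: homogeneous_def in_keys_iff)

lemma homogeneous_sum:
  "(\<And>i. i \<in> I \<Longrightarrow> f i \<in> homogeneous n) \<Longrightarrow> sum f I \<in> homogeneous n"
  by (induction I rule: infinite_finite_induct)
    (auto intro: homogeneous_add, simp_all add: homogeneous_def)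

lemma homogeneous_basis: "basis i \<in> homogeneous (gdeg i)"
  by (simp add: homogeneous_def)

lemma graded_linearI:
  fixes f :: "('i::graded_index \<Rightarrow>\<^sub>0 'k::field) \<Rightarrow> ('j::graded_index \<Rightarrow>\<^sub>0 'k)"
  assumes "klinear f" "\<And>i. f (basis i) \<in> homogeneous (gdeg i)"
  shows "graded_linear f"
  unfolding graded_linear_def
proof (intro conjI allI ballI)
  fix n and v :: "'i \<Rightarrow>\<^sub>0 'k" assume v: "v \<in> homogeneous n"
  have "f (basis i) \<in> homogeneous n" if "i \<in> Poly_Mapping.keys v" for i
    using assms(2)[of i] v that by (simp add: homogeneous_def)
  then show "f v \<in> homogeneous n"
    by (subst linear_expand[OF assms(1)]) (intro homogeneous_sum homogeneous_scale)
qed (rule assms(1))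

lemma klinear_eq_on_homogeneous:
  assumes "klinear f" "klinear g" "v \<in> homogeneous n"
    and "\<And>i. gdeg i = n \<Longrightarrow> f (basis i) = g (basis i)"
  shows "f v = g v"
  using assms(3,4) unfolding linear_expand[OF assms(1), of v] linear_expand[OF assms(2), of v]
  by (auto simp: homogeneous_def intro!: sum.cong)

lemma lookup_hproj:
  "Poly_Mapping.lookup (hproj n v) i = (if gdeg i = n then Poly_Mapping.lookup v i else 0)"
  by (simp add: hproj_def lookup_mapp when_def in_keys_iff)

lemma hproj_homogeneous: "hproj n v \<in> homogeneous n"
  by (auto simp: homogeneous_def in_keys_iff lookup_hproj split: if_splits)

lemma hproj_basis: "hproj n (basis i) = (if gdeg i = n then basis i else 0)"
  by (rule poly_mapping_eqI) (auto simp: lookup_hproj lookup_single when_def)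

lemma component_basis: "gdeg i = n \<Longrightarrow> component n f (basis i) = f (basis i)"
  by (simp add: component_def hproj_basis)

text \<open>Only the summand of index \<open>gdeg i\<close> survives, since
  \<open>f 0 = 0\<close>.\<close>

lemma component_le_basis:
  assumes "klinear f" "gdeg i \<le> n"
  shows "component_le n f (basis i) = f (basis i)"
proof -
  have "f 0 = 0"
    using klinear_scale[OF assms(1), of 0 0] by simp
  then have "component_le n f (basis i) = (\<Sum>k\<le>n. if k = gdeg i then f (basis i) else 0)"
    unfolding component_le_def component_def by (intro sum.cong) (auto simp: hproj_basis)
  then show ?thesis using assms(2) by simp
qed

lemma component_eqI:
  assumes "klinear f" "klinear g" "\<And>i. gdeg i = n \<Longrightarrow> f (basis i) = g (basis i)"
  shows "component n f = component n g"
  unfolding component_def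
  by (intro ext klinear_eq_on_homogeneous[OF assms(1,2) hproj_homogeneous assms(3)])

section \<open>Monomials, the values S_n and the coefficients of \<tau>\<close>

lemma gdeg_pair: "gdeg (i::nat, j::nat) = i + j"
  by (simp add: gdeg_prod_def gdeg_nat_def)

text \<open>\<open>single_one\<close> rewrites \<open>basis 0\<close> to \<open>1\<close>; used
  backwards, this equation makes \<open>tensor_basis\<close> applicable to tensors with a
  unit.\<close>

lemma basis_zero: "(basis 0 :: 'i::monoid_add \<Rightarrow>\<^sub>0 'k::field) = 1"
  by simp

lemma indet_power: "(indet :: nat \<Rightarrow>\<^sub>0 'k::field) ^ n = basis n"
  by (induction n) (simp_all add: indet_def mult_single)

text \<open>Vajda's identity for the Lucas sequence with parameters 1 and c. As functions of a, both
  sides satisfy the recurrence of S_n, so agreement at a = 0 and a = 1 suffices.\<close>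

lemma S_poly_identity:
  fixes c :: "'k::field"
  defines "s \<equiv> \<lambda>n. poly (S_poly n) c"
  shows "s (a + b) * s (b + d) = s b * s (a + b + d) + c ^ b * s a * s d"
proof -
  \<comment> \<open>At n = 0 this relies on the dummy value S_0 = 0.\<close>
  have rec: "s (Suc (Suc n)) = s (Suc n) - c * s n" for n
    by (cases n) (simp_all add: s_def)
  have s01: "s 0 = 0" "s (Suc 0) = 1"
    by (simp_all add: s_def)
  have base: "s (Suc b) * s (b + d) = s b * s (Suc (b + d)) + c ^ b * s d" for b
    by (induction b) (simp_all add: s01 rec algebra_simps)
  show ?thesis
  proof (induction a rule: induct_nat_012)
    case 0
    then show ?case by (simp add: s01)
  next
    case 1
    then show ?case using base by (simp add: s01)
  next
    case (ge2 a)
    then show ?case by (simp add: rec algebra_simps)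
  qed
qed

text \<open>
  The coefficients of \<open>x\<^sup>i\<^sup>+\<^sup>j \<otimes> 1\<close> and \<open>1 \<otimes> y\<^sup>i\<^sup>+\<^sup>j\<close> in \<open>\<tau>(y\<^sup>i \<otimes> x\<^sup>j)\<close>. For \<open>i = j = 0\<close> the quotient
  is \<open>0 / 0\<close>, and the two tensors coincide; the values \<open>1\<close> and \<open>0\<close> keep the hexagon identities
  valid.
\<close>

definition twist_x :: "'k::field \<Rightarrow> nat \<Rightarrow> nat \<Rightarrow> 'k"
  where "twist_x c i j =
    (if i + j = 0 then 1 else poly (S_poly j) c / poly (S_poly (i + j)) c)"

definition twist_y :: "'k::field \<Rightarrow> nat \<Rightarrow> nat \<Rightarrow> 'k"
  where "twist_y c i j = c ^ j * poly (S_poly i) c / poly (S_poly (i + j)) c"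

definition S_twist :: "'k::field \<Rightarrow> (nat \<times> nat \<Rightarrow>\<^sub>0 'k) \<Rightarrow> (nat \<times> nat \<Rightarrow>\<^sub>0 'k)"
  where "S_twist c =
    lin_ext (\<lambda>(i, j). twist_x c i j *\<^sub>s basis (i + j, 0) + twist_y c i j *\<^sub>s basis (0, i + j))"

lemma S_twist_basis:
  "S_twist c (basis (i, j)) =
     twist_x c i j *\<^sub>s basis (i + j, 0) + twist_y c i j *\<^sub>s basis (0, i + j)"
  by (simp add: S_twist_def)

lemma klinear_S_twist: "klinear (S_twist c)"
  unfolding S_twist_def by (rule linear_lin_ext)

section \<open>The twisting equation in bounded degree\<close>

text \<open>
  The twisting equation with its last, respectively first, tensor factor equal to \<open>1\<close>.
\<close>

lemma hexagons_to_degree: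
  fixes t :: "(nat \<times> nat \<Rightarrow>\<^sub>0 'k::field) \<Rightarrow> (nat \<times> nat \<Rightarrow>\<^sub>0 'k)"
  assumes tw: "graded_twisting_to_degree n t"
    and low: "t (basis (p, q)) = \<alpha> *\<^sub>s basis (p + q, 0) + \<beta> *\<^sub>s basis (0, p + q)"
    and deg: "p + q + r = n"
  shows "t (basis (r + p, q)) = \<alpha> *\<^sub>s t (basis (r, p + q)) + \<beta> *\<^sub>s basis (0, n)"
    and "t (basis (p, q + r)) = \<alpha> *\<^sub>s basis (n, 0) + \<beta> *\<^sub>s t (basis (p + q, r))"
proof -
  have lin: "klinear t" and gr: "\<And>m v. v \<in> homogeneous m \<Longrightarrow> t v \<in> homogeneous m"
    using tw by (auto simp: graded_twisting_to_degree_def graded_linear_def)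
  define T where "T = component_le n t"
  have T: "T (basis (i, j)) = t (basis (i, j))" if "i + j \<le> n" for i j
    unfolding T_def by (rule component_le_basis[OF lin]) (simp add: gdeg_pair that)
  have hom: "basis i \<in> homogeneous i" for i :: nat
    by (simp add: homogeneous_def gdeg_nat_def)
  have tx: "t (basis (0, k)) = basis (k, 0)" and ty: "t (basis (k, 0)) = basis (0, k)"
    if "k \<le> n" for k
    using tw hom[of k] that unfolding graded_twisting_to_degree_def
    by (metis basis_zero tensor_basis)+
  let ?m = "alg_mult \<otimes>\<^sub>m alg_mult :: ((nat \<times> nat) \<times> (nat \<times> nat) \<Rightarrow>\<^sub>0 'k) \<Rightarrow> _"
  have eq: "t (basis (a + b, d + e)) = ?m (mid T ((T \<otimes>\<^sub>m T) (mid T (basis ((a, b), (d, e))))))"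
    if "a + b + d + e = n" for a b d e
  proof -
    have "basis ((a, b), (d, e)) \<in> homogeneous n"
      using that by (simp add: homogeneous_def gdeg_prod_def gdeg_nat_def)
    then have "component n t (?m (basis ((a, b), (d, e)))) =
        ?m (mid T ((T \<otimes>\<^sub>m T) (mid T (basis ((a, b), (d, e))))))"
      using tw unfolding graded_twisting_to_degree_def T_def by blast
    then show ?thesis
      using that by (simp add: tensor_map_basis alg_mult_basis component_basis gdeg_pair)
  qed
  have lin': "klinear (\<lambda>v. ?m (mid T v))"
    by (intro klinear_compose[OF klinear_mid klinear_tensor_map])
  \<comment> \<open>Here u stands for an unknown value of t in degree n. The remaining application
    of t only meets a unit, so multiplication gives back u.\<close>
  have right: "?m (mid T (u \<otimes> basis (0, 0))) = u"
    and left: "?m (mid T (basis (0, 0) \<otimes> u)) = u" if u: "u \<in> homogeneous n" for u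
  proof -
    have lin_id: "klinear (\<lambda>u :: nat \<times> nat \<Rightarrow>\<^sub>0 'k. u)"
      by (rule pm.linear_ident)
    have unit: "?m (mid T (basis i \<otimes> basis (0, 0))) = basis i"
      "?m (mid T (basis (0, 0) \<otimes> basis i)) = basis i" if "gdeg i = n" for i
      using that by (cases i; simp add: mid_basis T tx ty tensor_map_basis alg_mult_basis gdeg_pair)+
    show "?m (mid T (u \<otimes> basis (0, 0))) = u"
      by (rule klinear_eq_on_homogeneous[OF klinear_compose[OF linear_tensor_left lin'] lin_id u unit(1)])
    show "?m (mid T (basis (0, 0) \<otimes> u)) = u"
      by (rule klinear_eq_on_homogeneous[OF klinear_compose[OF linear_tensor_right lin'] lin_id u unit(2)])
  qed
  have hom_t: "t (basis (i, j)) \<in> homogeneous n" if "i + j = n" for i j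
    using gr[OF homogeneous_basis[of "(i, j)"]] that by (simp add: gdeg_pair)
  note lins = klinear_simps[OF linear_lin_ext] klinear_simps[OF klinear_tensor_map]
    klinear_simps[OF klinear_mid]
  \<comment> \<open>On y^r \<otimes> y^p \<otimes> x^q \<otimes> 1 the \<alpha>-summand leaves t(y^r
    \<otimes> x^(p+q)) beside units, and the \<beta>-summand meets only unital conditions. On 1
    \<otimes> y^p \<otimes> x^q \<otimes> x^r the two summands exchange roles.\<close>
  show "t (basis (r + p, q)) = \<alpha> *\<^sub>s t (basis (r, p + q)) + \<beta> *\<^sub>s basis (0, n)"
    using eq[of r p q 0] deg
    by (simp add: mid_basis T low lins tensor_map_basis tx ty right hom_t alg_mult_basis
        tensor_simps add_ac del: single_one)
  show "t (basis (p, q + r)) = \<alpha> *\<^sub>s basis (n, 0) + \<beta> *\<^sub>s t (basis (p + q, r))"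
    using eq[of 0 p q r] deg
    by (simp add: mid_basis T low lins tensor_map_basis tx ty left hom_t alg_mult_basis
        tensor_simps add_ac del: single_one)
qed

section \<open>The map \<tau> and the hexagon identities for its coefficients\<close>

context
  fixes c :: "'k::field"
  assumes S_nonzero: "\<forall>n\<ge>1. poly (S_poly n) c \<noteq> 0"
begin

lemma S_nz: "n \<noteq> 0 \<Longrightarrow> poly (S_poly n) c \<noteq> 0"
  using S_nonzero by simp

lemma twist_unital:
  "twist_x c 0 j = 1" "twist_y c 0 j = 0" "twist_x c (Suc i) 0 = 0" "twist_y c (Suc i) 0 = 1"
  using S_nz[of j] S_nz[of "Suc i"] by (auto simp: twist_x_def twist_y_def)

text \<open>Compatibility with the product of B. The first identity telescopes; clearing
  denominators in the second leaves c^d times \<open>S_poly_identity\<close>.\<close>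

lemma hexagon_left:
  "twist_x c (a + b) d = twist_x c b d * twist_x c a (b + d)"
  "twist_y c (a + b) d = twist_x c b d * twist_y c a (b + d) + twist_y c b d"
proof -
  show "twist_x c (a + b) d = twist_x c b d * twist_x c a (b + d)"
    using S_nz[of "b + d"] S_nz[of "a + b + d"]
    by (auto simp: twist_x_def add.assoc)
  show "twist_y c (a + b) d = twist_x c b d * twist_y c a (b + d) + twist_y c b d"
  \<comment> \<open>For b = d = 0 the denominator is S_0 = 0; there the chosen values 1 and 0 give
    the claim.\<close>
  proof (cases "b + d = 0")
    case True
    then show ?thesis by (simp add: twist_x_def twist_y_def)
  next
    case False
    have "c ^ d * (poly (S_poly (a + b)) c * poly (S_poly (b + d)) c) =
      c ^ d * (poly (S_poly b) c * poly (S_poly (a + b + d)) c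
        + c ^ b * poly (S_poly a) c * poly (S_poly d) c)"
      by (simp only: S_poly_identity)
    with False S_nz[of "b + d"] S_nz[of "a + b + d"] show ?thesis
      by (simp add: twist_x_def twist_y_def divide_simps power_add algebra_simps)
  qed
qed

text \<open>Compatibility with the product of A. Now the y-coefficients telescope and the
  x-coefficients need \<open>S_poly_identity\<close>.\<close>

lemma hexagon_right:
  "twist_x c a (d + e) = twist_x c a d + twist_y c a d * twist_x c (a + d) e"
  "twist_y c a (d + e) = twist_y c a d * twist_y c (a + d) e"
proof -
  show "twist_x c a (d + e) = twist_x c a d + twist_y c a d * twist_x c (a + d) e"
  proof (cases "a + d = 0")
    case True
    then show ?thesis by (simp add: twist_unital)
  next
    case False
    with S_nz[of "a + d"] S_nz[of "a + d + e"] S_poly_identity[of a d c e] show ?thesis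
      by (simp add: twist_x_def twist_y_def divide_simps algebra_simps)
  qed
  show "twist_y c a (d + e) = twist_y c a d * twist_y c (a + d) e"
    using S_nz[of "a + d"] S_nz[of "a + d + e"]
    by (cases "a + d = 0") (simp_all add: twist_y_def power_add add.assoc)
qed

lemma S_twist_unital_basis:
  "S_twist c (basis (0, j)) = basis (j, 0)" "S_twist c (basis (i, 0)) = basis (0, i)"
proof -
  show "S_twist c (basis (0, j)) = basis (j, 0)"
    by (simp add: S_twist_basis twist_unital)
  show "S_twist c (basis (i, 0)) = basis (0, i)"
    by (cases i) (simp_all add: S_twist_basis twist_unital)
qed

lemma unital_twisting_S_twist: "unital_twisting (S_twist c)"
  unfolding unital_twisting_def
proof (intro conjI allI)
  have "(\<lambda>a. S_twist c (1 \<otimes> a)) = (\<lambda>a. a \<otimes> 1)"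
    by (rule linear_eqI[OF klinear_compose[OF linear_tensor_right klinear_S_twist] linear_tensor_left])
      (simp add: basis_zero[symmetric] S_twist_unital_basis del: single_one)
  then show "S_twist c (1 \<otimes> a) = a \<otimes> 1" for a by (rule fun_cong)
  have "(\<lambda>b. S_twist c (b \<otimes> 1)) = (\<lambda>b. 1 \<otimes> b)"
    by (rule linear_eqI[OF klinear_compose[OF linear_tensor_left klinear_S_twist] linear_tensor_right])
      (simp add: basis_zero[symmetric] S_twist_unital_basis del: single_one)
  then show "S_twist c (b \<otimes> 1) = 1 \<otimes> b" for b by (rule fun_cong)
qed

text \<open>The unital conditions fix the values for i = 0 or j = 0, the explicit formula all
  others. This yields existence and uniqueness of \<tau> and reduces the other claims to
  \<open>S_twist c\<close>.\<close>

lemma defining_conditions_iff: "defining_conditions c t \<longleftrightarrow> t = S_twist c"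
proof
  show "defining_conditions c t" if "t = S_twist c"
    unfolding defining_conditions_def that Let_def
    using klinear_S_twist unital_twisting_S_twist
    by (auto simp: indet_power basis_zero[symmetric] S_twist_basis twist_x_def twist_y_def
        simp del: single_one intro!: poly_mapping_eqI simp: lookup_add field_simps)
next
  assume t: "defining_conditions c t"
  have lin: "klinear t" and unit: "unital_twisting t"
    using t by (auto simp: defining_conditions_def)
  have "t (basis (i, j)) = S_twist c (basis (i, j))" for i j
  proof (cases "i = 0 \<or> j = 0")
    case True
    then show ?thesis
      using unit S_twist_unital_basis unfolding unital_twisting_def
      by (metis basis_zero tensor_basis)
  next
    case False
    then have "t (indet ^ i \<otimes> indet ^ j) = S_twist c (indet ^ i \<otimes> indet ^ j)"
      using t unfolding defining_conditions_def Let_def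
      by (auto simp: indet_power basis_zero[symmetric] S_twist_basis twist_x_def twist_y_def
        simp del: single_one intro!: poly_mapping_eqI simp: lookup_add field_simps)
    then show ?thesis by (simp add: indet_power)
  qed
  then show "t = S_twist c"
    by (intro linear_eqI[OF lin klinear_S_twist]) auto
qed

section \<open>Grading and twisting equation for \<tau>\<close>

lemma graded_linear_S_twist: "graded_linear (S_twist c)"
proof (rule graded_linearI[OF klinear_S_twist])
  show "S_twist c (basis p) \<in> homogeneous (gdeg p)" for p
    by (cases p, simp only: S_twist_basis, intro homogeneous_add homogeneous_scale)
      (simp_all add: homogeneous_def gdeg_pair)
qed

text \<open>On a basis vector of degree n both sides are combinations of x^n \<otimes> 1 and 1
  \<otimes> y^n, so only two coefficients have to be compared.\<close>

lemma graded_twisting_map_S_twist: "graded_twisting_map (S_twist c)"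
  unfolding graded_twisting_map_def
proof (intro conjI graded_linear_S_twist unital_twisting_S_twist)
  let ?t = "S_twist c"
  let ?m = "alg_mult \<otimes>\<^sub>m alg_mult :: ((nat \<times> nat) \<times> (nat \<times> nat) \<Rightarrow>\<^sub>0 'k) \<Rightarrow> _"
  show "?t \<circ> ?m = ?m \<circ> mid ?t \<circ> (?t \<otimes>\<^sub>m ?t) \<circ> mid ?t"
  proof (rule linear_eqI)
    show "klinear (?t \<circ> ?m)" "klinear (?m \<circ> mid ?t \<circ> (?t \<otimes>\<^sub>m ?t) \<circ> mid ?t)"
      unfolding o_def
      by (intro klinear_compose[OF _ klinear_S_twist] klinear_compose[OF _ klinear_tensor_map]
          klinear_compose[OF _ klinear_mid] klinear_tensor_map klinear_mid)+
  next
    fix p :: "(nat \<times> nat) \<times> (nat \<times> nat)"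
    obtain a b d e where p: "p = ((a, b), (d, e))" by (metis surj_pair)
    define n where "n = a + b + d + e"
    note lins = klinear_simps[OF linear_lin_ext] klinear_simps[OF klinear_tensor_map]
      klinear_simps[OF klinear_mid]
    have "(?m \<circ> mid ?t \<circ> (?t \<otimes>\<^sub>m ?t) \<circ> mid ?t) (basis p) =
      twist_x c b d *\<^sub>s (twist_x c a (b + d) *\<^sub>s basis (n, 0) + twist_y c a (b + d) *\<^sub>s
        (twist_x c (a + b + d) e *\<^sub>s basis (n, 0) + twist_y c (a + b + d) e *\<^sub>s basis (0, n)))
      + twist_y c b d *\<^sub>s (twist_x c (b + d) e *\<^sub>s
        (twist_x c a (b + d + e) *\<^sub>s basis (n, 0) + twist_y c a (b + d + e) *\<^sub>s basis (0, n))
        + twist_y c (b + d) e *\<^sub>s basis (0, n))"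
      by (simp add: p n_def mid_basis lins S_twist_unital_basis tensor_map_basis tensor_simps
          alg_mult_basis S_twist_basis[of c b d] S_twist_basis[of c a "b + d"]
          S_twist_basis[of c "a + (b + d)" e] S_twist_basis[of c "b + d" e]
          S_twist_basis[of c a "b + (d + e)"] add.assoc
          del: single_one)
    also have "\<dots> = twist_x c (a + b) (d + e) *\<^sub>s basis (n, 0)
        + twist_y c (a + b) (d + e) *\<^sub>s basis (0, n)"
    proof -
      \<comment> \<open>The right hexagon splits d + e, then the left one splits a + b, both against
        d and inside the coefficient of (a + b + d, e).\<close>
      have "twist_x c (a + b) (d + e) =
          twist_x c b d * (twist_x c a (b + d) + twist_y c a (b + d) * twist_x c (a + b + d) e)
          + twist_y c b d * (twist_x c (b + d) e * twist_x c a (b + d + e))"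
        using hexagon_left(1)[of a "b + d" e]
        by (simp add: hexagon_right(1)[of "a + b" d e] hexagon_left[of a b d] algebra_simps)
      moreover have "twist_y c (a + b) (d + e) =
          twist_x c b d * (twist_y c a (b + d) * twist_y c (a + b + d) e)
          + twist_y c b d * (twist_x c (b + d) e * twist_y c a (b + d + e) + twist_y c (b + d) e)"
        using hexagon_left(2)[of a "b + d" e]
        by (simp add: hexagon_right(2)[of "a + b" d e] hexagon_left[of a b d] algebra_simps)
      ultimately show ?thesis
        by (auto intro!: poly_mapping_eqI simp: lookup_add algebra_simps)
    qed
    also have "\<dots> = (?t \<circ> ?m) (basis p)"
      by (simp add: p n_def tensor_map_basis alg_mult_basis S_twist_basis add.assoc)
    finally show "(?t \<circ> ?m) (basis p) = (?m \<circ> mid ?t \<circ> (?t \<otimes>\<^sub>m ?t) \<circ> mid ?t) (basis p)"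
      by simp
  qed
qed

section \<open>Unique extension\<close>

lemma unique_extension_property_S_twist: "unique_extension_property (S_twist c)"
  unfolding unique_extension_property_def
proof (intro allI impI, elim conjE)
  fix n :: nat and t'
  assume n: "n \<ge> 3" and gl: "graded_linear t'" and tw: "graded_twisting_to_degree n t'"
    and low: "\<forall>i<n. component i t' = component i (S_twist c)"
  have lin: "klinear t'"
    using gl by (simp add: graded_linear_def)
  have below: "t' (basis (i, j)) = S_twist c (basis (i, j))" if "i + j < n" for i j
    using low that component_basis[of "(i, j)" "i + j"] by (metis gdeg_pair)
  define D where "D i j = t' (basis (i, j)) - S_twist c (basis (i, j))" for i j
  \<comment> \<open>Since r is nonzero, p + q < n and t' is known at (p, q). Both t' and \<tau>
    satisfy the same affine hexagons, whose constant terms cancel in the difference.\<close>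
  have D_left: "D (r + p) q = twist_x c p q *\<^sub>s D r (p + q)"
    and D_right: "D p (q + r) = twist_y c p q *\<^sub>s D (p + q) r"
    if "p + q + r = n" "r \<noteq> 0" for p q r
  proof -
    have b: "t' (basis (p, q)) =
        twist_x c p q *\<^sub>s basis (p + q, 0) + twist_y c p q *\<^sub>s basis (0, p + q)"
      using that by (subst below) (auto simp: S_twist_basis)
    have n_eq: "r + (p + q) = n" "p + (q + r) = n" "p + q + r = n" "r + p + q = n"
      using that by auto
    show "D (r + p) q = twist_x c p q *\<^sub>s D r (p + q)"
      unfolding D_def hexagons_to_degree(1)[OF tw b that(1)]
      by (rule poly_mapping_eqI)
        (simp add: S_twist_basis n_eq lookup_add lookup_minus hexagon_left[of r p q], simp add: algebra_simps)
    show "D p (q + r) = twist_y c p q *\<^sub>s D (p + q) r"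
      unfolding D_def hexagons_to_degree(2)[OF tw b that(1)]
      by (rule poly_mapping_eqI)
        (simp add: S_twist_basis n_eq lookup_add lookup_minus hexagon_right[of p q r], simp add: algebra_simps)
  qed
  \<comment> \<open>The indices n - 2 = m + 1, n - 1 and n are now visibly positive, so their
    S-values are nonzero.\<close>
  obtain m where m: "n = m + 3"
    using n by (metis add.commute le_Suc_ex)
  have D1: "D 1 (m + 2) = 0"
  proof -
    have "D 1 (m + 2) = twist_y c 1 (m + 1) *\<^sub>s twist_x c (m + 1) 1 *\<^sub>s D 1 (m + 2)"
      using D_right[of 1 "m + 1" 1] D_left[of "m + 1" 1 1] by (simp add: m)
    then have "D 1 (m + 2) = (twist_y c 1 (m + 1) * twist_x c (m + 1) 1) *\<^sub>s D 1 (m + 2)"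
      by simp
    moreover have "twist_y c 1 (m + 1) * twist_x c (m + 1) 1 \<noteq> 1"
    proof
      assume "twist_y c 1 (m + 1) * twist_x c (m + 1) 1 = 1"
      then have "c ^ (m + 1) = poly (S_poly (m + 2)) c * poly (S_poly (m + 2)) c"
        using S_nz[of "m + 2"] by (simp add: twist_x_def twist_y_def field_simps)
      \<comment> \<open>The case a = d = 1, b = m + 1 is Cassini's identity S_(m+2)^2 = S_(m+1)
        S_(m+3) + c^(m+1); the assumption would make S_(m+1) S_(m+3) vanish.\<close>
      then show False
        using S_poly_identity[of 1 "m + 1" c 1] S_nz[of "m + 1"] S_nz[of "m + 3"]
        by (simp add: numeral_3_eq_3)
    qed
    ultimately show ?thesis
      by (metis pm.scale_cancel_right pm.scale_one)
  qed
  have D0: "D i j = 0" if ij: "i + j = n" for i j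
  proof (cases "i = 0")
    case True
    have "t' (basis (0, n)) = basis (n, 0)"
    proof -
      have "(basis n :: nat \<Rightarrow>\<^sub>0 'k) \<in> homogeneous n"
        by (simp add: homogeneous_def gdeg_nat_def)
      then show ?thesis
        using tw unfolding graded_twisting_to_degree_def
        by (metis basis_zero le_refl tensor_basis)
    qed
    then show ?thesis using True ij by (simp add: D_def S_twist_unital_basis)
  next
    case False
    then obtain p where "i = 1 + p" by (metis Suc_pred' neq0_conv plus_1_eq_Suc)
    \<comment> \<open>Splitting off one y makes \<open>D i j\<close> a multiple of
      \<open>D 1 (p + j)\<close>, and p + j = m + 2.\<close>
    then show ?thesis
      using D_left[of p j 1] D1 ij m by simp
  qed
  show "component n t' = component n (S_twist c)"
  proof (rule component_eqI[OF lin klinear_S_twist])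
    fix p :: "nat \<times> nat" assume "gdeg p = n"
    then show "t' (basis p) = S_twist c (basis p)"
      using D0 by (cases p) (auto simp: gdeg_pair D_def)
  qed
qed

end

theorem theorem6p5:
  fixes c :: "'k::field"
  assumes "\<forall>n\<ge>1. poly (S_poly n) c \<noteq> 0"
  shows "(\<exists>!\<tau>. defining_conditions c \<tau>) \<and>
    (\<forall>\<tau>. defining_conditions c \<tau> \<longrightarrow> graded_twisting_map \<tau> \<and> unique_extension_property \<tau>)"
  using defining_conditions_iff[OF assms] graded_twisting_map_S_twist[OF assms]
    unique_extension_property_S_twist[OF assms]
  by auto

end
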